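(* Let $a<b$, $K\ge2$, $\mathcal{I}=\{1,\dots,K\}$, $\mathscr{D}\subseteq D_{cdf}([a,b])$ nonempty and convex, and $\mathsf{T}:D_{cdf}([a,b])\to\mathbb{R}$ with $|\mathsf{T}(F)-\mathsf{T}(G)|\le C\|F-G\|_\infty$ for all $F\in\mathscr{D}$, $G\in D_{cdf}([a,b])$, for some $C>0$. Assume that for every $m\in\mathbb{N}$ and $\delta\in\mathscr{S}_m$ the map $x\mapsto\mathsf{T}(\sum_{j=1}^m\delta_j\mathbf{1}\{x_j\le\cdot\})$ on $[a,b]^m$ is Borel measurable. Let $\mathscr{M}_K\subseteq\mathscr{S}_K$ be closed with at least two elements. Let $n\ge K$, let $\Pi_n=(\Pi_{n,1},\dots,\Pi_{n,K})$ be a partition of $\{1,\dots,n\}$ into nonempty sets, let $\mathscr{M}_K^n\subseteq\mathscr{M}_K$ be nonempty and finite, and set $\beta_n=\min_j|\Pi_{n,j}|$. Then the static assignment policy $\hat\pi$ satisfies $$\sup_{F^1,\dots,F^K\in\mathscr{D}}\mathbb{E}[r_n(\hat\pi,\mathscr{M}_K)]\le\varepsilon(n)+3.01\,C\sqrt{\log(K)/\beta_n},$$ where the supremum is over all i.i.d. potential outcome distributions whose marginal cdfs $F^1,\dots,F^K$ lie in $\mathscr{D}$ (arbitrary dependence between components).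
   Context: $D_{cdf}([a,b])$: cdfs $F$ on $\mathbb{R}$ with $F(a-)=0$, $F(b)=1$; $\|\cdot\|_\infty$ sup norm; $\mathscr{S}_K=\{\delta\in[0,1]^K:\sum\delta_i=1\}$; $\langle\delta,\mathbf{F}\rangle=\sum_i\delta_iF^i$. Setting: potential outcome vectors $Y_t=(Y_{1,t},\dots,Y_{K,t})$, $t\in\mathbb{N}$, i.i.d., $Y_{i,t}$ with cdf $F^i$. Static assignment (SA) policy $\hat\pi$: subject $t\in\{1,\dots,n\}$ is assigned to treatment $j$ iff $t\in\Pi_{n,j}$; then $\hat F^j_{n,\Pi_n}(\cdot)=|\Pi_{n,j}|^{-1}\sum_{t\in\Pi_{n,j}}\mathbf{1}\{Y_{j,t}\le\cdot\}$, $\hat{\mathbf{F}}_{n,\Pi_n}=(\hat F^1_{n,\Pi_n},\dots,\hat F^K_{n,\Pi_n})$, and the recommendation is $\hat\pi_{n,n+1}=\min\arg\max_{\delta\in\mathscr{M}_K^n}\mathsf{T}(\langle\delta,\hat{\mathbf{F}}_{n,\Pi_n}\rangle)$, the minimum with respect to the lexicographic order on $\mathbb{R}^K$. Regret: $r_n(\hat\pi,\mathscr{M}_K)=\max_{\delta\in\mathscr{M}_K}\mathsf{T}(\langle\delta,\mathbf{F}\rangle)-\mathsf{T}(\langle\hat\pi_{n,n+1},\mathbf{F}\rangle)$. Optimization error: $\varepsilon(n)=\sup_{\mathbf{F}\in\mathscr{D}^K}\big|\max_{\delta\in\mathscr{M}_K}\mathsf{T}(\langle\delta,\mathbf{F}\rangle)-\max_{\delta\in\mathscr{M}_K^n}\mathsf{T}(\langle\delta,\mathbf{F}\rangle)\big|$.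 *)

theory Defs
  imports "HOL-Probability.Probability"
begin

text \<open>Treatments are indexed by 0..<K and subjects by 0..<n (the paper uses 1-based
indices; the relabelling is order preserving).  Weight vectors are functions
nat => real vanishing outside 0..<K.\<close>

definition D_cdf :: "real \<Rightarrow> real \<Rightarrow> (real \<Rightarrow> real) set" where
  "D_cdf a b = {F. mono F \<and> (\<forall>x. continuous (at_right x) F)
                  \<and> (\<forall>x<a. F x = 0) \<and> (\<forall>x\<ge>b. F x = 1)}"

definition sup_dist :: "(real \<Rightarrow> real) \<Rightarrow> (real \<Rightarrow> real) \<Rightarrow> real" where
  "sup_dist F G = (SUP x. \<bar>F x - G x\<bar>)"

definition prob_simplex :: "nat \<Rightarrow> (nat \<Rightarrow> real) set" where
  "prob_simplex K = {\<delta>. (\<forall>i<K. 0 \<le> \<delta> i \<and> \<delta> i \<le> 1) \<and> (\<forall>i\<ge>K. \<delta> i = 0) \<and> (\<Sum>i<K. \<delta> i) = 1}"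

definition mix :: "nat \<Rightarrow> (nat \<Rightarrow> real) \<Rightarrow> (nat \<Rightarrow> real \<Rightarrow> real) \<Rightarrow> (real \<Rightarrow> real)" where
  "mix K \<delta> F = (\<lambda>x. \<Sum>i<K. \<delta> i * F i x)"

definition lex_less :: "nat \<Rightarrow> (nat \<Rightarrow> real) \<Rightarrow> (nat \<Rightarrow> real) \<Rightarrow> bool" where
  "lex_less K \<delta> \<delta>' = (\<exists>i<K. (\<forall>j<i. \<delta> j = \<delta>' j) \<and> \<delta> i < \<delta>' i)"

definition argmax_set :: "nat \<Rightarrow> ((real \<Rightarrow> real) \<Rightarrow> real) \<Rightarrow> (nat \<Rightarrow> real) set
     \<Rightarrow> (nat \<Rightarrow> real \<Rightarrow> real) \<Rightarrow> (nat \<Rightarrow> real) set" where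
  "argmax_set K T M F = {\<delta>\<in>M. \<forall>\<delta>'\<in>M. T (mix K \<delta>' F) \<le> T (mix K \<delta> F)}"

definition lex_min_argmax :: "nat \<Rightarrow> ((real \<Rightarrow> real) \<Rightarrow> real) \<Rightarrow> (nat \<Rightarrow> real) set
     \<Rightarrow> (nat \<Rightarrow> real \<Rightarrow> real) \<Rightarrow> (nat \<Rightarrow> real)" where
  "lex_min_argmax K T M F =
     (THE \<delta>. \<delta> \<in> argmax_set K T M F \<and>
            (\<forall>\<delta>'\<in>argmax_set K T M F. \<delta>' \<noteq> \<delta> \<longrightarrow> lex_less K \<delta> \<delta>'))"

text \<open>Empirical cdf of treatment j from the sample omega (omega t j = Y_{j,t}).\<close>
definition emp_cdf :: "(nat \<Rightarrow> nat set) \<Rightarrow> nat \<Rightarrow> (nat \<Rightarrow> nat \<Rightarrow> real) \<Rightarrow> real \<Rightarrow> real" where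
  "emp_cdf Part j \<omega> = (\<lambda>x. (\<Sum>t\<in>Part j. if \<omega> t j \<le> x then 1 else 0) / real (card (Part j)))"

definition sa_policy :: "nat \<Rightarrow> ((real \<Rightarrow> real) \<Rightarrow> real) \<Rightarrow> (nat \<Rightarrow> real) set
     \<Rightarrow> (nat \<Rightarrow> nat set) \<Rightarrow> (nat \<Rightarrow> nat \<Rightarrow> real) \<Rightarrow> (nat \<Rightarrow> real)" where
  "sa_policy K T Mn Part \<omega> = lex_min_argmax K T Mn (\<lambda>j. emp_cdf Part j \<omega>)"

definition regret :: "nat \<Rightarrow> ((real \<Rightarrow> real) \<Rightarrow> real) \<Rightarrow> (nat \<Rightarrow> real) set
     \<Rightarrow> (nat \<Rightarrow> real \<Rightarrow> real) \<Rightarrow> (nat \<Rightarrow> real) \<Rightarrow> real" where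
  "regret K T M F \<delta> = (SUP \<delta>'\<in>M. T (mix K \<delta>' F)) - T (mix K \<delta> F)"

definition opt_error :: "nat \<Rightarrow> ((real \<Rightarrow> real) \<Rightarrow> real) \<Rightarrow> (real \<Rightarrow> real) set
     \<Rightarrow> (nat \<Rightarrow> real) set \<Rightarrow> (nat \<Rightarrow> real) set \<Rightarrow> real" where
  "opt_error K T D M Mn =
     (SUP F\<in>{F. \<forall>i<K. F i \<in> D}.
        \<bar>(SUP \<delta>\<in>M. T (mix K \<delta> F)) - (SUP \<delta>\<in>Mn. T (mix K \<delta> F))\<bar>)"

definition marg :: "(nat \<Rightarrow> real) measure \<Rightarrow> nat \<Rightarrow> real \<Rightarrow> real" where
  "marg P i = (\<lambda>x. measure P {y\<in>space P. y i \<le> x})"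

end

theory Submission
  imports Defs
begin

text \<open>By optimality of the recommendation on the empirical cdfs and the Lipschitz property, the regret
is at most the optimization error plus \<open>2 C Z\<close>, where \<open>Z\<close> is the largest uniform distance
between an empirical and a true marginal cdf.  The expectation of \<open>Z\<close> is controlled by a
Dvoretzky-Kiefer-Wolfowitz inequality
\<open>P (sup \<bar>F\<^sub>m - F\<bar> \<ge> e) \<le> 2 exp (- (31/20) m e\<^sup>2)\<close>.  The exponent 31/20, instead of the
optimal 2, suffices because \<open>4 (1 + ln (2 K)) \<le> (31/20) * 3.01\<^sup>2 * ln K\<close>, the tightest case
being \<open>K = 2\<close>.

For nested events \<open>A\<close> with counts \<open>N A\<close> among \<open>m\<close> i.i.d. points,
\<open>(1 + \<kappa> / P A) ^ N A / (1 + \<kappa>) ^ m\<close> is a martingale as \<open>A\<close> decreases.  With \<open>\<kappa> = 2 e\<close> it is at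
least \<open>exp ((31/20) m e\<^sup>2)\<close> as soon as \<open>N A \<ge> m (P A + e)\<close>, so that the one-sided inequality
follows from the maximal inequality.  The other side is obtained from the complementary events.\<close>

subsection \<open>The likelihood ratio at a crossing\<close>

lemma reciprocal_sum:
  fixes z :: real
  assumes "0 \<le> z" "z < 1"
  shows "1 / (1 + z) + 1 / (1 - z) = 2 / (1 - z\<^sup>2)"
proof -
  have "1 - z\<^sup>2 = (1 + z) * (1 - z)" by (simp add: power2_eq_square algebra_simps)
  with assms show ?thesis by (simp add: divide_simps)
qed

text \<open>\<open>ln ((1 + x) / (1 - x))\<close> vanishes at 0 and is convex on [0, 1), so
  shrinking the argument by \<open>q\<close> shrinks the value at least by \<open>q\<close>. With
  \<open>x = e / q\<close> this moves a general frequency \<open>q\<close> to the extreme case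
  \<open>q = 1\<close>.\<close>

lemma logit_star_shaped:
  fixes q x :: real
  assumes "0 \<le> q" "q \<le> 1" "0 \<le> x" "x < 1"
  shows "ln ((1 + q * x) / (1 - q * x)) \<le> q * ln ((1 + x) / (1 - x))"
proof -
  have qy: "0 \<le> q * y" "q * y \<le> y" if "0 \<le> y" for y
    using assms that by (auto simp: mult_left_le_one_le)
  define h where "h = (\<lambda>y. q * (ln (1 + y) - ln (1 - y)) - (ln (1 + q * y) - ln (1 - q * y)))"
  have "h 0 \<le> h x"
  proof (rule DERIV_nonneg_imp_nondecreasing[of 0 x h, OF \<open>0 \<le> x\<close>])
    fix y assume y: "0 \<le> y" "y \<le> x"
    have y1: "y < 1" "q * y < 1" "0 \<le> q * y" "q * y \<le> y" using assms y qy[of y] by auto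
    have "(h has_real_derivative q * (1 / (1 + y) + 1 / (1 - y)) - q * (1 / (1 + q * y) + 1 / (1 - q * y))) (at y)"
      unfolding h_def using y y1 by (auto intro!: derivative_eq_intros simp: divide_inverse algebra_simps)
    moreover have "q * (1 / (1 + y) + 1 / (1 - y)) - q * (1 / (1 + q * y) + 1 / (1 - q * y))
        = 2 * q * (1 / (1 - y\<^sup>2) - 1 / (1 - (q * y)\<^sup>2))"
      unfolding reciprocal_sum[OF y(1) y1(1)] reciprocal_sum[OF y1(3,2)] by (simp add: algebra_simps)
    moreover have "1 / (1 - (q * y)\<^sup>2) \<le> 1 / (1 - y\<^sup>2)"
      using y y1 by (intro divide_left_mono mult_pos_pos) (auto simp: power_less_one_iff abs_square_less_1 intro: power_mono)
    ultimately show "\<exists>d. (h has_real_derivative d) (at y) \<and> 0 \<le> d"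
      using assms by (metis diff_ge_0_iff_ge mult_nonneg_nonneg zero_le_numeral)
  qed
  moreover have "q * x < 1" using qy[of x] assms by linarith
  ultimately show ?thesis
    using assms qy[of x] unfolding h_def by (simp add: ln_div)
qed

lemma cubic_nonneg:
  fixes e :: real assumes "0 \<le> e" "e \<le> 1"
  shows "0 \<le> 9/10 - 21/5 * e + 31/10 * e\<^sup>2 + 31/5 * e ^ 3"
proof -
  \<comment> \<open>Expansion around 1/3, close to the minimiser; the linear remainder decreases and
    is still 4/135 at \<open>e = 1\<close>.\<close>
  have "9/10 - 21/5 * e + 31/10 * e\<^sup>2 + 31/5 * e ^ 3
      = 31/5 * ((e - 1/3)\<^sup>2 * (e + 2/3)) + 31/10 * (e - 1/3)\<^sup>2 + (13/135 - e/15)"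
    by (simp add: power2_eq_square power3_eq_cube algebra_simps) (simp add: field_simps)
  also have "\<dots> \<ge> 0" using assms by (intro add_nonneg_nonneg mult_nonneg_nonneg) auto
  finally show ?thesis .
qed

text \<open>Both sides vanish at 0, and the derivative of their difference is \<open>y\<close> times
  the cubic of \<open>cubic_nonneg\<close> over a positive denominator. This limits the exponent:
  for any constant above 63/40 in place of 31/20 that derivative would be negative at 1/3.\<close>

lemma logit_minus_ln_ge:
  fixes e :: real
  assumes "0 \<le> e" "e < 1"
  shows "31/20 * e\<^sup>2 \<le> ln ((1 + e) / (1 - e)) - ln (1 + 2 * e)"
proof -
  define h where "h = (\<lambda>y::real. ln (1 + y) - ln (1 - y) - ln (1 + 2 * y) - 31/20 * y\<^sup>2)"
  have "h 0 \<le> h e"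
  proof (rule DERIV_nonneg_imp_nondecreasing[of 0 e h, OF \<open>0 \<le> e\<close>])
    fix y assume y: "0 \<le> y" "y \<le> e"
    have y1: "y < 1" using assms y by auto
    have pos: "0 < 1 - y\<^sup>2" using y y1 by (simp add: abs_square_less_1)
    have d: "(h has_real_derivative 1 / (1 + y) + 1 / (1 - y) - 2 / (1 + 2 * y) - 31/10 * y) (at y)"
      unfolding h_def using y y1 by (auto intro!: derivative_eq_intros)
    have "1 / (1 + y) + 1 / (1 - y) - 2 / (1 + 2 * y) - 31/10 * y
        = (2 * (1 + 2 * y) - 2 * (1 - y\<^sup>2) - 31/10 * y * ((1 - y\<^sup>2) * (1 + 2 * y))) / ((1 - y\<^sup>2) * (1 + 2 * y))"
      unfolding reciprocal_sum[OF y(1) y1] using y y1 pos by (simp add: divide_simps)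
    also have "2 * (1 + 2 * y) - 2 * (1 - y\<^sup>2) - 31/10 * y * ((1 - y\<^sup>2) * (1 + 2 * y))
        = y * (9/10 - 21/5 * y + 31/10 * y\<^sup>2 + 31/5 * y ^ 3)"
      by algebra
    finally have eq: "1 / (1 + y) + 1 / (1 - y) - 2 / (1 + 2 * y) - 31/10 * y
        = y * (9/10 - 21/5 * y + 31/10 * y\<^sup>2 + 31/5 * y ^ 3) / ((1 - y\<^sup>2) * (1 + 2 * y))" .
    show "\<exists>d. (h has_real_derivative d) (at y) \<and> 0 \<le> d"
    proof (intro exI conjI)
      show "0 \<le> 1 / (1 + y) + 1 / (1 - y) - 2 / (1 + 2 * y) - 31/10 * y"
        unfolding eq using y y1 pos cubic_nonneg[of y]
        by (intro divide_nonneg_nonneg mult_nonneg_nonneg) auto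
    qed (rule d)
  qed
  then show ?thesis using assms unfolding h_def by (simp add: ln_div)
qed

text \<open>With \<open>q = k / m\<close> one has \<open>p \<le> q - e\<close>, and \<open>q * ln ((q + e) / (q - e))\<close> is smallest at
\<open>q = 1\<close>, so the claim reduces to an inequality in \<open>e\<close> alone.\<close>
lemma crossing_likelihood_ratio:
  fixes p e :: real and k m :: nat
  assumes "0 < e" "0 \<le> p" "real m * (p + e) \<le> real k" "k \<le> m" "0 < m"
  shows "exp (31/20 * real m * e\<^sup>2) * (1 + 2 * e) ^ m * p ^ k \<le> (p + 2 * e) ^ k"
proof (cases "p = 0")
  case True
  have "0 < real m * (p + e)" using assms by auto
  then have "0 < k" using assms by linarith
  then show ?thesis using True assms by (auto simp: zero_power)
next
  case False
  with assms have p: "0 < p" by simp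
  define q where "q = real k / real m"
  have q: "p + e \<le> q" "q \<le> 1" using assms by (auto simp: q_def field_simps)
  have e1: "e < 1" "e < q" using q p by auto
  have "31/20 * e\<^sup>2 + ln (1 + 2 * e) \<le> ln ((1 + e) / (1 - e))"
    using logit_minus_ln_ge[of e] assms e1 by simp
  also have "\<dots> \<le> q * ln ((1 + e / q) / (1 - e / q))"
    using logit_star_shaped[of q "e / q"] q e1 assms by auto
  also have "(1 + e / q) / (1 - e / q) = 1 + 2 * e / (q - e)"
    using e1 assms by (simp add: field_simps)
  also have "q * ln (1 + 2 * e / (q - e)) \<le> q * ln (1 + 2 * e / p)"
    using assms q p e1 by (intro mult_left_mono ln_mono add_left_mono frac_le add_pos_nonneg) auto
  finally have "real m * (31/20 * e\<^sup>2 + ln (1 + 2 * e)) \<le> real m * (q * ln (1 + 2 * e / p))"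
    by (intro mult_left_mono) auto
  also have "real m * (q * ln (1 + 2 * e / p)) = real k * ln (1 + 2 * e / p)"
    using assms by (simp add: q_def)
  finally have "exp (real m * (31/20 * e\<^sup>2 + ln (1 + 2 * e))) \<le> exp (real k * ln (1 + 2 * e / p))"
    by simp
  also have "exp (real k * ln (1 + 2 * e / p)) = (1 + 2 * e / p) ^ k"
    using assms p by (subst exp_of_nat_mult) (simp add: add_pos_nonneg)
  also have "exp (real m * (31/20 * e\<^sup>2 + ln (1 + 2 * e))) = exp (31/20 * real m * e\<^sup>2) * (1 + 2 * e) ^ m"
  proof -
    have "real m * (31/20 * e\<^sup>2 + ln (1 + 2 * e)) = 31/20 * real m * e\<^sup>2 + real m * ln (1 + 2 * e)"
      by (simp add: algebra_simps)
    then show ?thesis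
      using assms by (simp only: exp_add exp_of_nat_mult) simp
  qed
  finally have "exp (31/20 * real m * e\<^sup>2) * (1 + 2 * e) ^ m * p ^ k \<le> (1 + 2 * e / p) ^ k * p ^ k"
    using p by (intro mult_right_mono) auto
  also have "\<dots> = ((1 + 2 * e / p) * p) ^ k" by (simp only: power_mult_distrib)
  also have "(1 + 2 * e / p) * p = p + 2 * e" using p by (simp add: field_simps)
  finally show ?thesis .
qed

subsection \<open>A maximal inequality for nested events\<close>

text \<open>The unnormalised form of a reverse martingale.  Label \<open>i\<close> by the index of the
innermost set containing the point \<open>i\<close>, and put an additional mass \<open>\<kappa>\<close> on the innermost
label.  Once the count \<open>k\<close> in the set number \<open>l\<close> is known, only the points inside see the additional
mass, so it multiplies the weight by \<open>((p l + \<kappa>) / p l) ^ k\<close> with \<open>p l = sum w {l..N}\<close>,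
which is at least \<open>\<Lambda>\<close> at a bad count; the total mass becomes \<open>(1 + \<kappa>) ^ card I\<close>.\<close>
lemma weighted_label_maximal_inequality:
  fixes w :: "nat \<Rightarrow> real" and \<kappa> \<Lambda> :: real and bad :: "nat \<Rightarrow> nat \<Rightarrow> bool"
  assumes w: "\<And>l. 0 \<le> w l" and \<kappa>: "0 \<le> \<kappa>" and \<Lambda>: "0 < \<Lambda>"
    and bad: "\<And>l k. bad l k \<Longrightarrow> \<Lambda> * sum w {l..N} ^ k \<le> (sum w {l..N} + \<kappa>) ^ k"
    and "j \<le> Suc N" and "finite I"
  shows "(\<Sum>f | f \<in> I \<rightarrow>\<^sub>E {j..N} \<and> (\<exists>l\<in>{j..N}. bad l (card {i\<in>I. l \<le> f i})). \<Prod>i\<in>I. w (f i))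
           \<le> (sum w {j..N} + \<kappa>) ^ card I / \<Lambda>"
    (is "sum _ (?B j I) \<le> _")
  using \<open>j \<le> Suc N\<close> \<open>finite I\<close>
proof (induction j arbitrary: I rule: inc_induct)
  case base
  then show ?case using \<kappa> \<Lambda> by simp
next
  case (step j)
  then have j: "j \<le> N" by simp
  have finB: "finite (?B k S)" if "finite S" for k S
    by (rule finite_subset[of _ "S \<rightarrow>\<^sub>E {k..N}"]) (use that in \<open>auto intro: finite_PiE\<close>)
  have sum_j: "sum w {j..N} = w j + sum w {Suc j..N}"
    using j by (simp add: sum.atLeast_Suc_atMost)
  show ?case
  proof (cases "bad j (card I)")
    \<comment> \<open>Every labelling by \<open>{j..N}\<close> has count \<open>card I\<close> in
      set number \<open>j\<close>, so here all of them are bad, and the total weight is bounded by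
      the hypothesis at this one count.\<close>
    case True
    have "(\<Sum>f\<in>?B j I. \<Prod>i\<in>I. w (f i)) \<le> (\<Sum>f\<in>I \<rightarrow>\<^sub>E {j..N}. \<Prod>i\<in>I. w (f i))"
      using \<open>finite I\<close> by (intro sum_mono2 finite_PiE prod_nonneg w) auto
    also have "\<dots> = sum w {j..N} ^ card I"
      using \<open>finite I\<close> by (subst prod_sum_PiE[symmetric]) auto
    also have "\<dots> \<le> (sum w {j..N} + \<kappa>) ^ card I / \<Lambda>"
      using bad[OF True] \<Lambda> by (simp add: field_simps)
    finally show ?thesis .
  next
    case False
    \<comment> \<open>Labellings are grouped by the set of points lying deeper than level
      \<open>j\<close>. On a fibre all other points have label \<open>j\<close>, so the restriction
      to \<open>X\<close> determines the labelling; as level \<open>j\<close> is not bad, some bad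
      level is at least \<open>Suc j\<close> and is visible in that restriction.\<close>
    define S where "S = (\<lambda>f::'a \<Rightarrow> nat. {i\<in>I. Suc j \<le> f i})"
    have fibre: "(\<Sum>f | f \<in> ?B j I \<and> S f = X. \<Prod>i\<in>I. w (f i))
        \<le> w j ^ card (I - X) * ((sum w {Suc j..N} + \<kappa>) ^ card X / \<Lambda>)" (is "sum _ ?F \<le> _")
      if X: "X \<in> Pow I" for X
    proof -
      have fX: "finite X" "finite (I - X)" using X \<open>finite I\<close> by (auto intro: finite_subset)
      have split: "f i = j" if "f \<in> ?F" "i \<in> I - X" for f i
        using that by (auto simp: S_def PiE_iff not_less_eq_eq)
      have inj: "inj_on (\<lambda>f. restrict f X) ?F"
      proof (rule inj_onI)
        fix f g assume f: "f \<in> ?F" and g: "g \<in> ?F" and eq: "restrict f X = restrict g X"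
        show "f = g"
        proof
          fix i consider "i \<in> X" | "i \<in> I - X" | "i \<notin> I" by blast
          then show "f i = g i"
          proof cases
            case 1 then show ?thesis using fun_cong[OF eq, of i] by simp
          next
            case 2 then show ?thesis using split[OF f] split[OF g] by simp
          next
            case 3 then show ?thesis using f g by (auto simp: PiE_iff extensional_def)
          qed
        qed
      qed
      have img: "(\<lambda>f. restrict f X) ` ?F \<subseteq> ?B (Suc j) X"
      proof
        fix g assume "g \<in> (\<lambda>f. restrict f X) ` ?F"
        then obtain f l where g: "g = restrict f X" and f: "f \<in> I \<rightarrow>\<^sub>E {j..N}"
          and l: "l \<in> {j..N}" "bad l (card {i\<in>I. l \<le> f i})" and X': "X = S f"
          by auto
        have "g \<in> X \<rightarrow>\<^sub>E {Suc j..N}" using f by (auto simp: S_def PiE_iff g X')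
        moreover have "l \<noteq> j"
        proof
          assume "l = j"
          with f have "{i\<in>I. l \<le> f i} = I" by (auto simp: PiE_iff)
          with l \<open>l = j\<close> False show False by simp
        qed
        moreover have "{i\<in>I. l \<le> f i} = {i\<in>S f. l \<le> restrict f (S f) i}" if "Suc j \<le> l"
          using that by (auto simp: S_def)
        ultimately show "g \<in> ?B (Suc j) X"
          using l unfolding g X' by (intro CollectI conjI bexI[of _ l]) auto
      qed
      have "(\<Sum>f\<in>?F. \<Prod>i\<in>I. w (f i)) = (\<Sum>f\<in>?F. w j ^ card (I - X) * (\<Prod>i\<in>X. w (restrict f X i)))"
      proof (rule sum.cong[OF refl])
        fix f assume f: "f \<in> ?F"
        have "(\<Prod>i\<in>I. w (f i)) = (\<Prod>i\<in>I - X. w (f i)) * (\<Prod>i\<in>X. w (f i))"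
          using X \<open>finite I\<close> by (intro prod.subset_diff) auto
        also have "(\<Prod>i\<in>I - X. w (f i)) = w j ^ card (I - X)"
          using split[OF f] by simp
        finally show "(\<Prod>i\<in>I. w (f i)) = w j ^ card (I - X) * (\<Prod>i\<in>X. w (restrict f X i))"
          by simp
      qed
      also have "\<dots> = w j ^ card (I - X) * (\<Sum>g\<in>(\<lambda>f. restrict f X) ` ?F. \<Prod>i\<in>X. w (g i))"
        unfolding sum.reindex[OF inj] by (simp add: sum_distrib_left)
      also have "\<dots> \<le> w j ^ card (I - X) * (\<Sum>g\<in>?B (Suc j) X. \<Prod>i\<in>X. w (g i))"
        by (intro mult_left_mono sum_mono2 finB fX img prod_nonneg w zero_le_power)
      also have "\<dots> \<le> w j ^ card (I - X) * ((sum w {Suc j..N} + \<kappa>) ^ card X / \<Lambda>)"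
        by (intro mult_left_mono step.IH fX zero_le_power w)
      finally show ?thesis .
    qed
    have "(\<Sum>f\<in>?B j I. \<Prod>i\<in>I. w (f i))
        = (\<Sum>X\<in>Pow I. \<Sum>f | f \<in> ?B j I \<and> S f = X. \<Prod>i\<in>I. w (f i))"
      using \<open>finite I\<close> by (intro sum.group[symmetric] finB) (auto simp: S_def)
    also have "\<dots> \<le> (\<Sum>X\<in>Pow I. w j ^ card (I - X) * ((sum w {Suc j..N} + \<kappa>) ^ card X / \<Lambda>))"
      by (intro sum_mono fibre)
    \<comment> \<open>A binomial expansion read backwards: each point contributes either
      \<open>w j\<close> or the inner mass together with \<open>\<kappa>\<close>.\<close>
    also have "\<dots> = (\<Sum>X\<in>Pow I. (\<Prod>i\<in>X. sum w {Suc j..N} + \<kappa>) * (\<Prod>i\<in>I - X. w j)) / \<Lambda>"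
      by (simp add: sum_divide_distrib mult.commute)
    also have "\<dots> = (sum w {j..N} + \<kappa>) ^ card I / \<Lambda>"
      using \<open>finite I\<close> by (subst prod_add[symmetric]) (auto simp: sum_j add_ac)
    finally show ?thesis .
  qed
qed

lemma product_prob_space_const:
  "prob_space P \<Longrightarrow> product_prob_space (\<lambda>_. P)"
  by (simp add: product_prob_space_def product_prob_space_axioms_def product_sigma_finite_def prob_space_imp_sigma_finite)

text \<open>The label of a point is the index of the layer \<open>A l - A (Suc l)\<close> containing
  it. Labels of independent points are independent with weights \<open>w l\<close>, and
  \<open>box f\<close> is the cylinder of samples whose labels on \<open>I\<close> are
  \<open>f\<close>, so the weighted count becomes a probability. Keeping \<open>I\<close> apart from
  \<open>J\<close> lets several samples share one product space.\<close>

lemma nested_sets_maximal_inequality: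
  fixes A :: "nat \<Rightarrow> 'a set" and \<kappa> \<Lambda> :: real
  assumes P: "prob_space P" and J: "finite J" "I \<subseteq> J"
    and A: "\<And>l. A l \<in> sets P" "\<And>l. A (Suc l) \<subseteq> A l" "A 0 = space P" "A (Suc N) = {}"
    and \<kappa>: "0 \<le> \<kappa>" and \<Lambda>: "0 < \<Lambda>"
    and bad: "\<And>l k. bad l k \<Longrightarrow> \<Lambda> * measure P (A l) ^ k \<le> (measure P (A l) + \<kappa>) ^ k"
  shows "measure (PiM J (\<lambda>_. P)) {\<omega>\<in>space (PiM J (\<lambda>_. P)). \<exists>l\<le>N. bad l (card {i\<in>I. \<omega> i \<in> A l})}
           \<le> (1 + \<kappa>) ^ card I / \<Lambda>"
proof -
  interpret P: prob_space P by fact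
  interpret PJ: product_prob_space "\<lambda>_. P" J by (rule product_prob_space_const[OF P])
  have fI: "finite I" using J finite_subset by blast
  define w where "w l = measure P (A l - A (Suc l))" for l
  have anti: "A l \<subseteq> A k" if "k \<le> l" for k l
    using that by (induction rule: dec_induct) (use A(2) in auto)
  have tele: "sum w {l..N} = measure P (A l)" if "l \<le> Suc N" for l
    using that
  proof (induction l rule: inc_induct)
    case base then show ?case by (simp add: A)
  next
    case (step l)
    have "measure P (A l) = measure P (A l - A (Suc l)) + measure P (A (Suc l))"
      using A by (simp add: P.finite_measure_Diff)
    then show ?case using step by (simp add: sum.atLeast_Suc_atMost w_def)
  qed
  have tele_all: "sum w {l..N} = measure P (A l)" for l
  proof (cases "l \<le> Suc N")
    case False
    then have "A l = {}" using anti[of "Suc N" l] A(4) by auto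
    then show ?thesis using False by simp
  qed (rule tele)
  define label where "label y = (LEAST l. y \<notin> A (Suc l))" for y
  have label: "y \<in> A l \<longleftrightarrow> l \<le> label y" if y: "y \<in> space P" for y l
  proof -
    have ex: "y \<notin> A (Suc (label y))"
      unfolding label_def by (rule LeastI[of _ N]) (simp add: A)
    show ?thesis
    proof
      assume "y \<in> A l"
      with ex anti[of "Suc (label y)" l] show "l \<le> label y" by (meson not_less_eq_eq subsetD)
    next
      assume l: "l \<le> label y"
      show "y \<in> A l"
      proof (cases l)
        case 0 then show ?thesis using A y by simp
      next
        case (Suc k)
        then have "k < label y" using l by simp
        then show ?thesis using not_less_Least[of k "\<lambda>l. y \<notin> A (Suc l)"] Suc by (auto simp: label_def)
      qed
    qed
  qed
  define F where "F = {f. f \<in> I \<rightarrow>\<^sub>E {0..N} \<and> (\<exists>l\<in>{0..N}. bad l (card {i\<in>I. l \<le> f i}))}"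
  define box where "box f = prod_emb J (\<lambda>_. P) I (PiE I (\<lambda>i. A (f i) - A (Suc (f i))))" for f :: "'b \<Rightarrow> nat"
  have finF: "finite F" unfolding F_def
    by (rule finite_subset[of _ "I \<rightarrow>\<^sub>E {0..N}"]) (use fI in \<open>auto intro: finite_PiE\<close>)
  have box_sets: "box f \<in> sets (PiM J (\<lambda>_. P))" for f
    unfolding box_def using J A fI by (intro sets_PiM_I) auto
  have "{\<omega>\<in>space (PiM J (\<lambda>_. P)). \<exists>l\<le>N. bad l (card {i\<in>I. \<omega> i \<in> A l})} \<subseteq> (\<Union>f\<in>F. box f)"
  proof safe
    fix \<omega> l assume \<omega>: "\<omega> \<in> space (PiM J (\<lambda>_. P))" and l: "l \<le> N" "bad l (card {i\<in>I. \<omega> i \<in> A l})"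
    have sp: "\<omega> i \<in> space P" if "i \<in> I" for i using \<omega> that J by (auto simp: space_PiM PiE_iff)
    define f where "f = restrict (\<lambda>i. label (\<omega> i)) I"
    have fN: "f i \<le> N" if "i \<in> I" for i
      using label[OF sp[OF that], of "Suc N"] that by (simp add: A f_def)
    have "{i\<in>I. \<omega> i \<in> A l} = {i\<in>I. l \<le> f i}" using label[OF sp] by (auto simp: f_def)
    then have "f \<in> F" using l fN unfolding F_def by (intro CollectI conjI bexI[of _ l]) (auto simp: f_def)
    moreover have "\<omega> \<in> box f" unfolding box_def
      using \<omega> J label[OF sp] by (auto simp: prod_emb_iff f_def space_PiM PiE_iff restrict_def extensional_def)
    ultimately show "\<omega> \<in> (\<Union>f\<in>F. box f)" by blast
  qed
  then have "measure (PiM J (\<lambda>_. P)) {\<omega>\<in>space (PiM J (\<lambda>_. P)). \<exists>l\<le>N. bad l (card {i\<in>I. \<omega> i \<in> A l})}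
      \<le> measure (PiM J (\<lambda>_. P)) (\<Union>f\<in>F. box f)"
    by (intro PJ.finite_measure_mono) (use finF box_sets in auto)
  also have "\<dots> \<le> (\<Sum>f\<in>F. measure (PiM J (\<lambda>_. P)) (box f))"
    by (intro PJ.finite_measure_subadditive_finite finF) (use box_sets in auto)
  also have "\<dots> = (\<Sum>f\<in>F. \<Prod>i\<in>I. w (f i))"
    unfolding box_def w_def using J fI A by (intro sum.cong refl PJ.measure_PiM_emb) auto
  also have "\<dots> \<le> (sum w {0..N} + \<kappa>) ^ card I / \<Lambda>"
    unfolding F_def
    using fI \<kappa> \<Lambda> bad
    by (intro weighted_label_maximal_inequality) (auto simp: tele_all, simp add: w_def)
  also have "sum w {0..N} = 1" using tele[of 0] by (simp add: A P.prob_space)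
  finally show ?thesis .
qed

subsection \<open>The Dvoretzky-Kiefer-Wolfowitz inequality\<close>

lemma measurable_count_in:
  assumes "finite I" "I \<subseteq> J" "A \<in> sets P"
  shows "(\<lambda>\<omega>. real (card {i\<in>I. \<omega> i \<in> A})) \<in> borel_measurable (PiM J (\<lambda>_. P))"
proof -
  have "real (card {i\<in>I. \<omega> i \<in> A}) = (\<Sum>i\<in>I. indicator A (\<omega> i))" for \<omega>
    using assms(1) by (simp add: indicator_def sum.If_cases Int_def)
  moreover have "(\<lambda>\<omega>. indicator A (\<omega> i) :: real) \<in> borel_measurable (PiM J (\<lambda>_. P))" if "i \<in> I" for i
  proof -
    have "i \<in> J" using that assms by auto
    from measurable_compose[OF measurable_component_singleton[OF this] borel_measurable_indicator[OF assms(3)]]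
    show ?thesis .
  qed
  ultimately show ?thesis by (simp only:) (intro borel_measurable_sum)
qed

text \<open>The maximal inequality with \<open>\<kappa> = 2 * e\<close> and with
  \<open>\<Lambda>\<close> containing the factor \<open>(1 + 2 * e) ^ m\<close>, which cancels the
  numerator and leaves only the exponential.\<close>

lemma finite_chain_one_sided_dkw:
  fixes e :: real
  assumes P: "prob_space P" and J: "finite J" "I \<subseteq> J" "I \<noteq> {}" and e: "0 < e"
    and \<A>: "finite \<A>" "\<A> \<subseteq> sets P" "\<And>A B. A \<in> \<A> \<Longrightarrow> B \<in> \<A> \<Longrightarrow> A \<subseteq> B \<or> B \<subseteq> A"
  shows "measure (PiM J (\<lambda>_. P)) {\<omega>\<in>space (PiM J (\<lambda>_. P)).
            \<exists>A\<in>\<A>. real (card I) * (measure P A + e) \<le> real (card {i\<in>I. \<omega> i \<in> A})}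
          \<le> exp (- (31/20 * real (card I) * e\<^sup>2))"
proof -
  interpret PJ: product_prob_space "\<lambda>_. P" J by (rule product_prob_space_const[OF P])
  have fI: "finite I" using J finite_subset by blast
  define m where "m = card I"
  have m: "0 < m" using fI J by (simp add: m_def card_gt_0_iff)
  \<comment> \<open>Ranking the sets by inclusion, largest first, turns the chain into a decreasing sequence.\<close>
  define rank where "rank B = card {C\<in>\<A>. B \<subseteq> C}" for B
  \<comment> \<open>Index 0 is kept for the whole space, as \<open>rank\<close> is at least 1 on the
    chain; indices above \<open>card \<A>\<close> give the empty set.\<close>
  define A where "A l = (if l = 0 then space P else \<Union>{B\<in>\<A>. l \<le> rank B})" for l
  have rank_le: "rank B \<le> card \<A>" for B unfolding rank_def using \<A> by (intro card_mono) auto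
  have rank_pos: "0 < rank B" if "B \<in> \<A>" for B
    unfolding rank_def using that \<A> by (auto simp: card_gt_0_iff)
  have A_rank: "A (rank B) = B" if B: "B \<in> \<A>" for B
  proof -
    have "C \<subseteq> B" if C: "C \<in> \<A>" "rank B \<le> rank C" for C
    proof (rule ccontr)
      assume n: "\<not> C \<subseteq> B"
      with \<A>(3)[OF C(1) B] have "B \<subseteq> C" by blast
      with n B have "{D\<in>\<A>. C \<subseteq> D} \<subset> {D\<in>\<A>. B \<subseteq> D}" by blast
      then have "rank C < rank B" unfolding rank_def using \<A> by (intro psubset_card_mono) auto
      with C show False by simp
    qed
    then have "\<Union>{C\<in>\<A>. rank B \<le> rank C} = B" using B by blast
    then show ?thesis using rank_pos[OF B] by (simp add: A_def)
  qed
  have A_sets: "A l \<in> sets P" for l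
    unfolding A_def using \<A> by (auto intro!: sets.finite_Union)
  define N where "N = card \<A>"
  \<comment> \<open>The clause \<open>k \<le> m\<close> holds for every actual count
    (\<open>bad_eq\<close>); \<open>crossing_likelihood_ratio\<close> asks for it.\<close>
  define bad where "bad l k \<longleftrightarrow> real m * (measure P (A l) + e) \<le> real k \<and> k \<le> m" for l k
  have "measure (PiM J (\<lambda>_. P)) {\<omega>\<in>space (PiM J (\<lambda>_. P)). \<exists>l\<le>N. bad l (card {i\<in>I. \<omega> i \<in> A l})}
      \<le> (1 + 2 * e) ^ card I / (exp (31/20 * real m * e\<^sup>2) * (1 + 2 * e) ^ m)"
  proof (rule nested_sets_maximal_inequality[OF P J(1,2) A_sets])
    show "A (Suc l) \<subseteq> A l" for l
    proof (cases "l = 0")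
      case True
      then show ?thesis using sets.sets_into_space[OF A_sets] by (simp add: A_def[of 0])
    qed (auto simp: A_def)
    show "A (Suc N) = {}"
    proof -
      have "\<not> Suc N \<le> rank B" for B using rank_le[of B] by (simp add: N_def)
      then show ?thesis by (simp add: A_def)
    qed
    show "exp (31/20 * real m * e\<^sup>2) * (1 + 2 * e) ^ m * measure P (A l) ^ k \<le> (measure P (A l) + 2 * e) ^ k"
      if "bad l k" for l k
      using that e m by (intro crossing_likelihood_ratio) (auto simp: bad_def)
  qed (use e in \<open>auto simp: A_def\<close>)
  also have "\<dots> = exp (- (31/20 * real m * e\<^sup>2))"
    using e by (simp add: m_def exp_minus inverse_eq_divide)
  finally have bound: "measure (PiM J (\<lambda>_. P)) {\<omega>\<in>space (PiM J (\<lambda>_. P)). \<exists>l\<le>N. bad l (card {i\<in>I. \<omega> i \<in> A l})}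
      \<le> exp (- (31/20 * real m * e\<^sup>2))" .
  note [measurable] = measurable_count_in[OF fI J(2) A_sets]
  have bad_eq: "bad l (card {i\<in>I. \<omega> i \<in> A l}) \<longleftrightarrow> real m * (measure P (A l) + e) \<le> real (card {i\<in>I. \<omega> i \<in> A l})"
    for l \<omega>
    unfolding bad_def m_def by (auto intro!: card_mono fI)
  have "measure (PiM J (\<lambda>_. P)) {\<omega>\<in>space (PiM J (\<lambda>_. P)).
            \<exists>A\<in>\<A>. real (card I) * (measure P A + e) \<le> real (card {i\<in>I. \<omega> i \<in> A})}
     \<le> measure (PiM J (\<lambda>_. P)) {\<omega>\<in>space (PiM J (\<lambda>_. P)). \<exists>l\<le>N. bad l (card {i\<in>I. \<omega> i \<in> A l})}"
  proof (rule PJ.finite_measure_mono)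
    show "{\<omega>\<in>space (PiM J (\<lambda>_. P)).
            \<exists>A\<in>\<A>. real (card I) * (measure P A + e) \<le> real (card {i\<in>I. \<omega> i \<in> A})}
        \<subseteq> {\<omega>\<in>space (PiM J (\<lambda>_. P)). \<exists>l\<le>N. bad l (card {i\<in>I. \<omega> i \<in> A l})}"
    proof safe
      fix \<omega> B assume B: "B \<in> \<A>" "real (card I) * (measure P B + e) \<le> real (card {i\<in>I. \<omega> i \<in> B})"
      have "card {i\<in>I. \<omega> i \<in> B} \<le> m" unfolding m_def by (intro card_mono fI) auto
      with B rank_le[of B] show "\<exists>l\<le>N. bad l (card {i\<in>I. \<omega> i \<in> A l})"
        by (intro exI[of _ "rank B"]) (simp add: A_rank bad_def m_def N_def)
    qed
    show "{\<omega>\<in>space (PiM J (\<lambda>_. P)). \<exists>l\<le>N. bad l (card {i\<in>I. \<omega> i \<in> A l})} \<in> sets (PiM J (\<lambda>_. P))"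
      unfolding bad_eq by measurable
  qed
  with bound show ?thesis by (simp add: m_def)
qed

text \<open>Continuity from below: the events for finitely many initial sets increase to the event
  for the whole sequence, and the finite bound does not depend on their number.\<close>

lemma one_sided_dkw:
  fixes e :: real and A :: "nat \<Rightarrow> 'a set"
  assumes P: "prob_space P" and J: "finite J" "I \<subseteq> J" "I \<noteq> {}" and e: "0 < e"
    and A: "\<And>n. A n \<in> sets P" "\<And>m n. A m \<subseteq> A n \<or> A n \<subseteq> A m"
  shows "measure (PiM J (\<lambda>_. P)) {\<omega>\<in>space (PiM J (\<lambda>_. P)).
            \<exists>n. real (card I) * (measure P (A n) + e) \<le> real (card {i\<in>I. \<omega> i \<in> A n})}
          \<le> exp (- (31/20 * real (card I) * e\<^sup>2))"
proof -
  interpret PJ: product_prob_space "\<lambda>_. P" J by (rule product_prob_space_const[OF P])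
  define E where "E N = {\<omega>\<in>space (PiM J (\<lambda>_. P)).
            \<exists>B\<in>A ` {..N}. real (card I) * (measure P B + e) \<le> real (card {i\<in>I. \<omega> i \<in> B})}" for N
  have fI: "finite I" using J finite_subset by blast
  note [measurable] = measurable_count_in[OF fI J(2) A(1)]
  have "E N \<in> sets (PiM J (\<lambda>_. P))" for N
    unfolding E_def by (simp, measurable)
  then have "(\<lambda>N. measure (PiM J (\<lambda>_. P)) (E N)) \<longlonglongrightarrow> measure (PiM J (\<lambda>_. P)) (\<Union>N. E N)"
    by (intro PJ.finite_Lim_measure_incseq) (auto simp: incseq_def E_def intro: order_trans)
  moreover have "measure (PiM J (\<lambda>_. P)) (E N) \<le> exp (- (31/20 * real (card I) * e\<^sup>2))" for N
    unfolding E_def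
  proof (rule finite_chain_one_sided_dkw[OF P J e])
    show "B \<subseteq> C \<or> C \<subseteq> B" if "B \<in> A ` {..N}" "C \<in> A ` {..N}" for B C
      using that A(2) by blast
  qed (use A(1) in auto)
  ultimately have "measure (PiM J (\<lambda>_. P)) (\<Union>N. E N) \<le> exp (- (31/20 * real (card I) * e\<^sup>2))"
    by (intro LIMSEQ_le_const2) auto
  also have "(\<Union>N. E N) = {\<omega>\<in>space (PiM J (\<lambda>_. P)).
            \<exists>n. real (card I) * (measure P (A n) + e) \<le> real (card {i\<in>I. \<omega> i \<in> A n})}"
    by (auto simp: E_def)
  finally show ?thesis .
qed

text \<open>If the frequency of a half-line event is too low, that of its complement is too high by
  the same amount. Complements of a chain form a chain, so the one-sided bound applies to both
  families and the union bound gives the factor 2.\<close>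

lemma two_sided_dkw:
  fixes e :: real and X :: "'a \<Rightarrow> real" and r :: "nat \<Rightarrow> real"
  assumes P: "prob_space P" and J: "finite J" "I \<subseteq> J" "I \<noteq> {}" and e: "0 < e"
    and X: "X \<in> borel_measurable P"
  shows "measure (PiM J (\<lambda>_. P)) {\<omega>\<in>space (PiM J (\<lambda>_. P)).
            \<exists>n. e \<le> \<bar>real (card {i\<in>I. X (\<omega> i) \<le> r n}) / real (card I) - measure P {y\<in>space P. X y \<le> r n}\<bar>}
          \<le> 2 * exp (- (31/20 * real (card I) * e\<^sup>2))"
    (is "measure ?M ?E \<le> _")
proof -
  interpret P: prob_space P by fact
  interpret PJ: product_prob_space "\<lambda>_. P" J by (rule product_prob_space_const[OF P])
  have fI: "finite I" using J finite_subset by blast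
  then have m: "0 < card I" using J by (simp add: card_gt_0_iff)
  define A where "A n = {y\<in>space P. X y \<le> r n}" for n
  define B where "B n = space P - A n" for n
  have A_sets: "A n \<in> sets P" and B_sets: "B n \<in> sets P" for n
    using X unfolding A_def B_def by measurable
  have A_chain: "A k \<subseteq> A n \<or> A n \<subseteq> A k" for k n
    using linear[of "r k" "r n"] by (auto simp: A_def)
  then have B_chain: "B k \<subseteq> B n \<or> B n \<subseteq> B k" for k n
    by (auto simp: B_def)
  define EE where "EE S = {\<omega>\<in>space ?M.
      \<exists>n. real (card I) * (measure P (S n) + e) \<le> real (card {i\<in>I. \<omega> i \<in> S n})}" for S :: "nat \<Rightarrow> 'a set"
  have EE_sets: "EE S \<in> sets ?M" if "\<And>n. S n \<in> sets P" for S
  proof -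
    note [measurable] = measurable_count_in[OF fI J(2) that]
    show ?thesis unfolding EE_def by measurable
  qed
  have "?E \<subseteq> EE A \<union> EE B"
  proof safe
    fix \<omega> n
    assume \<omega>: "\<omega> \<in> space ?M" and n: "\<omega> \<notin> EE B"
      and dev: "e \<le> \<bar>real (card {i\<in>I. X (\<omega> i) \<le> r n}) / real (card I) - measure P {y\<in>space P. X y \<le> r n}\<bar>"
    have sp: "\<omega> i \<in> space P" if "i \<in> I" for i using \<omega> that J by (auto simp: space_PiM PiE_iff)
    have cA: "{i\<in>I. \<omega> i \<in> A n} = {i\<in>I. X (\<omega> i) \<le> r n}"
      and cB: "{i\<in>I. \<omega> i \<in> B n} = I - {i\<in>I. X (\<omega> i) \<le> r n}"
      using sp by (auto simp: A_def B_def)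
    have cB': "real (card {i\<in>I. \<omega> i \<in> B n}) = real (card I) - real (card {i\<in>I. X (\<omega> i) \<le> r n})"
      unfolding cB using fI by (subst card_Diff_subset) (auto intro!: of_nat_diff card_mono)
    have "measure P (B n) = 1 - measure P (A n)"
      unfolding B_def using A_sets by (rule P.prob_compl)
    moreover have "\<not> real (card I) * (measure P (B n) + e) \<le> real (card {i\<in>I. \<omega> i \<in> B n})"
      using n \<omega> unfolding EE_def by blast
    ultimately have lt: "real (card I) - real (card {i\<in>I. X (\<omega> i) \<le> r n}) < real (card I) * (1 - measure P (A n) + e)"
      by (simp only: cB' not_le)
    define c where "c = real (card {i\<in>I. X (\<omega> i) \<le> r n}) / real (card I)"
    have c: "real (card {i\<in>I. X (\<omega> i) \<le> r n}) = real (card I) * c" using m by (simp add: c_def)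
    have "real (card I) * (1 - c) < real (card I) * (1 - measure P (A n) + e)"
      using lt unfolding c by (simp only: right_diff_distrib mult_1_right)
    then have "- e < c - measure P (A n)" using m by simp
    then have "e \<le> c - measure P (A n)" using dev e by (simp add: A_def c_def)
    then have "real (card I) * (measure P (A n) + e) \<le> real (card I) * c"
      by (intro mult_left_mono) auto
    also have "\<dots> = real (card {i\<in>I. \<omega> i \<in> A n})" unfolding cA c ..
    finally show "\<omega> \<in> EE A" using \<omega> unfolding EE_def by blast
  qed
  then have "measure ?M ?E \<le> measure ?M (EE A \<union> EE B)"
    by (intro PJ.finite_measure_mono) (auto intro: EE_sets A_sets B_sets)
  also have "\<dots> \<le> measure ?M (EE A) + measure ?M (EE B)"
    by (intro measure_Un_le EE_sets A_sets B_sets)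
  also have "\<dots> \<le> exp (- (31/20 * real (card I) * e\<^sup>2)) + exp (- (31/20 * real (card I) * e\<^sup>2))"
    unfolding EE_def by (intro add_mono one_sided_dkw P J e A_sets B_sets A_chain B_chain)
  finally show ?thesis by simp
qed

text \<open>Bounding the second moment instead of the mean makes the tail integral elementary, and costs
little because \<open>Z\<close> concentrates.\<close>
lemma (in prob_space) expectation_le_of_subgaussian_tail:
  fixes Z :: "'a \<Rightarrow> real"
  assumes Z[measurable]: "Z \<in> borel_measurable M" and nn: "\<And>\<omega>. \<omega> \<in> space M \<Longrightarrow> 0 \<le> Z \<omega>"
    and bdd: "\<And>\<omega>. \<omega> \<in> space M \<Longrightarrow> Z \<omega> \<le> u"
    and c: "0 < c" and N: "1 \<le> N"
    and tail: "\<And>e. 0 < e \<Longrightarrow> prob {\<omega>\<in>space M. e < Z \<omega>} \<le> N * exp (- (c * e\<^sup>2))"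
  shows "expectation Z \<le> sqrt ((1 + ln N) / c)"
proof -
  interpret L: pair_sigma_finite M lborel ..
  \<comment> \<open>At \<open>s\<close> the bound \<open>N * exp (- (c * s))\<close> equals 1. Below
    \<open>s\<close> probabilities are bounded by 1, contributing \<open>ln N / c\<close>; above
    \<open>s\<close> the tail integrates to exactly \<open>1 / c\<close>.\<close>
  define s where "s = ln N / c"
  have s: "0 \<le> s" using c N by (simp add: s_def)
  have int: "integrable M Z"
    using nn bdd by (intro integrable_const_bound[of _ u]) auto
  have int2: "integrable M (\<lambda>\<omega>. (Z \<omega>)\<^sup>2)"
    using nn bdd by (intro integrable_const_bound[of _ "u\<^sup>2"]) (auto intro!: power_mono)
  define S where "S = {p\<in>space (M \<Otimes>\<^sub>M lborel). 0 \<le> snd p \<and> snd p < (Z (fst p))\<^sup>2}"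
  have "(\<integral>\<^sup>+\<omega>. ennreal ((Z \<omega>)\<^sup>2) \<partial>M)
      = (\<integral>\<^sup>+\<omega>. \<integral>\<^sup>+x. indicator {0..<(Z \<omega>)\<^sup>2} x \<partial>lborel \<partial>M)"
    by (simp add: nn_integral_indicator)
  also have "\<dots> = (\<integral>\<^sup>+\<omega>. \<integral>\<^sup>+x. indicator S (\<omega>, x) \<partial>lborel \<partial>M)"
    by (intro nn_integral_cong) (auto simp: indicator_def S_def space_pair_measure)
  also have "\<dots> = (\<integral>\<^sup>+x. \<integral>\<^sup>+\<omega>. indicator S (\<omega>, x) \<partial>M \<partial>lborel)"
    by (rule L.Fubini[symmetric]) (unfold S_def, measurable)
  also have "\<dots> \<le> (\<integral>\<^sup>+x. indicator {0..s} x + ennreal (N * exp (- (c * x))) * indicator {s..} x \<partial>lborel)"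
  proof (rule nn_integral_mono)
    fix x :: real
    have eq: "(\<integral>\<^sup>+\<omega>. indicator S (\<omega>, x) \<partial>M)
        = (if 0 \<le> x then ennreal (prob {\<omega>\<in>space M. x < (Z \<omega>)\<^sup>2}) else 0)"
    proof -
      have "(\<integral>\<^sup>+\<omega>. indicator S (\<omega>, x) \<partial>M)
          = (\<integral>\<^sup>+\<omega>. indicator {\<omega>\<in>space M. 0 \<le> x \<and> x < (Z \<omega>)\<^sup>2} \<omega> \<partial>M)"
        by (intro nn_integral_cong) (auto simp: indicator_def S_def space_pair_measure)
      also have "\<dots> = emeasure M {\<omega>\<in>space M. 0 \<le> x \<and> x < (Z \<omega>)\<^sup>2}"
        by (rule nn_integral_indicator) measurable
      finally show ?thesis by (simp add: emeasure_eq_measure)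
    qed
    consider "x < 0" | "0 \<le> x" "x \<le> s" | "s < x" "0 \<le> x" by linarith
    then show "(\<integral>\<^sup>+\<omega>. indicator S (\<omega>, x) \<partial>M)
        \<le> indicator {0..s} x + ennreal (N * exp (- (c * x))) * indicator {s..} x"
    proof cases
      case 1 then show ?thesis unfolding eq by simp
    next
      case 2
      then have "ennreal (prob {\<omega>\<in>space M. x < (Z \<omega>)\<^sup>2}) \<le> indicator {0..s} x"
        by (simp add: ennreal_le_1)
      then show ?thesis unfolding eq using 2 by (simp add: add_increasing2)
    next
      case 3
      have "x < (Z \<omega>)\<^sup>2 \<longleftrightarrow> sqrt x < Z \<omega>" if "\<omega> \<in> space M" for \<omega>
        using real_sqrt_less_iff[of x "(Z \<omega>)\<^sup>2"] nn[OF that] by simp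
      then have "{\<omega>\<in>space M. x < (Z \<omega>)\<^sup>2} = {\<omega>\<in>space M. sqrt x < Z \<omega>}"
        by auto
      then have "prob {\<omega>\<in>space M. x < (Z \<omega>)\<^sup>2} \<le> N * exp (- (c * x))"
        using tail[of "sqrt x"] 3 s by simp
      then show ?thesis unfolding eq using 3 s by (simp add: ennreal_leI)
    qed
  qed
  also have "\<dots> = ennreal s + (\<integral>\<^sup>+x. ennreal (N * exp (- (c * x))) * indicator {s..} x \<partial>lborel)"
    using s by (simp add: nn_integral_add)
  also have "(\<integral>\<^sup>+x. ennreal (N * exp (- (c * x))) * indicator {s..} x \<partial>lborel) = ennreal (0 - (- (N / c) * exp (- (c * s))))"
  proof (rule nn_integral_FTC_atLeast)
    show "((\<lambda>x. - (N / c) * exp (- (c * x))) \<longlongrightarrow> 0) at_top"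
      using c by real_asymp
    show "DERIV (\<lambda>x. - (N / c) * exp (- (c * x))) x :> N * exp (- (c * x))" for x
      using c by (auto intro!: derivative_eq_intros)
  qed (use c N in auto)
  also have "0 - (- (N / c) * exp (- (c * s))) = 1 / c"
    using c N by (simp add: s_def exp_minus)
  also have "ennreal s + ennreal (1 / c) = ennreal ((1 + ln N) / c)"
    using s c by (simp add: ennreal_plus[symmetric] s_def add_divide_distrib add.commute del: ennreal_plus)
  finally have "(\<integral>\<^sup>+\<omega>. ennreal ((Z \<omega>)\<^sup>2) \<partial>M) \<le> ennreal ((1 + ln N) / c)" .
  then have "expectation (\<lambda>\<omega>. (Z \<omega>)\<^sup>2) \<le> (1 + ln N) / c"
    using int2 c N by (simp add: nn_integral_eq_integral)
  moreover have "(expectation Z)\<^sup>2 \<le> expectation (\<lambda>\<omega>. (Z \<omega>)\<^sup>2)"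
    using variance_positive[of Z] variance_eq[OF int int2] by linarith
  ultimately show ?thesis by (intro real_le_rsqrt) linarith
qed

subsection \<open>Mixtures of cdfs and the lexicographic minimum\<close>

lemma D_cdf_bounds:
  assumes "G \<in> D_cdf a b" shows "0 \<le> G x" "G x \<le> 1"
proof -
  have G: "mono G" "\<And>x. x < a \<Longrightarrow> G x = 0" "\<And>x. b \<le> x \<Longrightarrow> G x = 1"
    using assms by (auto simp: D_cdf_def)
  have "G (min x (a - 1)) \<le> G x" "G x \<le> G (max x b)" using G(1) by (auto intro: monoD)
  moreover have "G (min x (a - 1)) = 0" "G (max x b) = 1"
    by (rule G(2), linarith, rule G(3), linarith)
  ultimately show "0 \<le> G x" "G x \<le> 1" by auto
qed

lemma sup_dist_le: "(\<And>x. \<bar>G x - H x\<bar> \<le> z) \<Longrightarrow> sup_dist G H \<le> z"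
  unfolding sup_dist_def by (rule cSUP_least) auto

lemma sup_dist_D_cdf_le_1:
  assumes "G \<in> D_cdf a b" "H \<in> D_cdf a b" shows "sup_dist G H \<le> 1"
proof (rule sup_dist_le)
  fix x show "\<bar>G x - H x\<bar> \<le> 1"
    using D_cdf_bounds[OF assms(1), of x] D_cdf_bounds[OF assms(2), of x] by linarith
qed

lemma mix_in_D_cdf:
  assumes \<delta>: "\<delta> \<in> prob_simplex K" and G: "\<And>i. i < K \<Longrightarrow> G i \<in> D_cdf a b"
  shows "mix K \<delta> G \<in> D_cdf a b"
  unfolding D_cdf_def mix_def
proof (intro CollectI conjI allI impI)
  show "mono (\<lambda>x. \<Sum>i<K. \<delta> i * G i x)"
    using \<delta> G by (intro monoI sum_mono mult_left_mono) (auto simp: prob_simplex_def D_cdf_def monoD)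
  show "continuous (at_right x) (\<lambda>x. \<Sum>i<K. \<delta> i * G i x)" for x
    using G by (intro continuous_sum continuous_mult continuous_const) (auto simp: D_cdf_def)
  show "(\<Sum>i<K. \<delta> i * G i x) = 0" if "x < a" for x
    using G that by (auto simp: D_cdf_def)
  show "(\<Sum>i<K. \<delta> i * G i x) = 1" if "b \<le> x" for x
    using G \<delta> that by (simp add: D_cdf_def prob_simplex_def)
qed

lemma continuous_at_right_step: "continuous (at_right x) (\<lambda>y::real. if c \<le> y then 1 else 0 :: real)"
proof -
  have "eventually (\<lambda>y. (if c \<le> y then 1 else 0 :: real) = (if c \<le> x then 1 else 0)) (at_right x)"
  proof (cases "c \<le> x")
    case True
    then show ?thesis unfolding eventually_at_right_field by (auto intro!: exI[of _ "x + 1"])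
  next
    case False
    then show ?thesis unfolding eventually_at_right_field by (intro exI[of _ c]) auto
  qed
  then show ?thesis unfolding continuous_within by (rule tendsto_eventually)
qed

lemma emp_cdf_in_D_cdf:
  assumes "finite (Part j)" "Part j \<noteq> {}" and Y: "\<And>t. t \<in> Part j \<Longrightarrow> \<omega> t j \<in> {a..b}"
  shows "emp_cdf Part j \<omega> \<in> D_cdf a b"
  unfolding D_cdf_def emp_cdf_def
proof (intro CollectI conjI allI impI)
  show "mono (\<lambda>x. (\<Sum>t\<in>Part j. if \<omega> t j \<le> x then 1 else 0) / real (card (Part j)))"
    by (intro monoI divide_right_mono sum_mono) auto
  show "continuous (at_right x) (\<lambda>x. (\<Sum>t\<in>Part j. if \<omega> t j \<le> x then 1 else 0) / real (card (Part j)))" for x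
    using assms(1,2) by (intro continuous_divide continuous_sum continuous_const continuous_at_right_step) auto
  show "(\<Sum>t\<in>Part j. if \<omega> t j \<le> x then 1 else 0) / real (card (Part j)) = 0" if "x < a" for x
  proof -
    have "\<not> \<omega> t j \<le> x" if "t \<in> Part j" for t using Y[OF that] \<open>x < a\<close> by auto
    then show ?thesis by simp
  qed
  show "(\<Sum>t\<in>Part j. if \<omega> t j \<le> x then 1 else 0) / real (card (Part j)) = 1" if "b \<le> x" for x
  proof -
    have "\<omega> t j \<le> x" if "t \<in> Part j" for t using Y[OF that] \<open>b \<le> x\<close> by auto
    then have "(\<Sum>t\<in>Part j. if \<omega> t j \<le> x then 1 else 0 :: real) = real (card (Part j))" by simp
    then show ?thesis using assms by simp
  qed
qed

text \<open>Convexity is given for two elements. Induction on the number of components needs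
  renormalised partial sums, hence weights of positive sum instead of a point of the simplex. If the
  earlier weights all vanish, the mixture is the last component.\<close>

lemma normalized_mix_in_convex:
  fixes D :: "(real \<Rightarrow> real) set"
  assumes convex: "\<forall>G\<in>D. \<forall>H\<in>D. \<forall>u::real. 0 \<le> u \<and> u \<le> 1 \<longrightarrow> (\<lambda>x. u * G x + (1 - u) * H x) \<in> D"
    and "\<And>i. i < K \<Longrightarrow> 0 \<le> \<delta> i" and "\<And>i. i < K \<Longrightarrow> G i \<in> D" and "0 < (\<Sum>i<(K::nat). \<delta> i)"
  shows "(\<lambda>x. (\<Sum>i<K. \<delta> i * G i x) / (\<Sum>i<K. \<delta> i)) \<in> D"
  using assms(2-)
proof (induction K)
  case (Suc K)
  have nn: "0 \<le> (\<Sum>i<K. \<delta> i)" using Suc.prems by (auto intro: sum_nonneg)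
  show ?case
  proof (cases "(\<Sum>i<K. \<delta> i) = 0")
    case True
    then have "\<delta> i = 0" if "i < K" for i
      using Suc.prems that by (subst (asm) sum_nonneg_eq_0_iff) auto
    moreover have "\<delta> K > 0" using True Suc.prems by simp
    ultimately show ?thesis using Suc.prems(2)[of K] by simp
  next
    case False
    define u where "u = (\<Sum>i<K. \<delta> i) / (\<Sum>i<Suc K. \<delta> i)"
    have u: "0 \<le> u" "u \<le> 1" "1 - u = \<delta> K / (\<Sum>i<Suc K. \<delta> i)"
      using nn Suc.prems by (auto simp: u_def divide_simps)
    have "(\<lambda>x. u * ((\<Sum>i<K. \<delta> i * G i x) / (\<Sum>i<K. \<delta> i)) + (1 - u) * G K x) \<in> D"
    proof (rule convex[rule_format])
      show "(\<lambda>x. (\<Sum>i<K. \<delta> i * G i x) / (\<Sum>i<K. \<delta> i)) \<in> D"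
        using Suc.IH Suc.prems nn False by auto
    qed (use Suc.prems u in auto)
    moreover have "u * ((\<Sum>i<K. \<delta> i * G i x) / (\<Sum>i<K. \<delta> i)) + (1 - u) * G K x
        = (\<Sum>i<Suc K. \<delta> i * G i x) / (\<Sum>i<Suc K. \<delta> i)" for x
      unfolding u(3) using False by (simp add: u_def add_divide_distrib)
    ultimately show ?thesis by simp
  qed
qed simp

lemma mix_in_convex:
  fixes D :: "(real \<Rightarrow> real) set"
  assumes "\<forall>G\<in>D. \<forall>H\<in>D. \<forall>u::real. 0 \<le> u \<and> u \<le> 1 \<longrightarrow> (\<lambda>x. u * G x + (1 - u) * H x) \<in> D"
    and "\<delta> \<in> prob_simplex K" and "\<And>i. i < K \<Longrightarrow> G i \<in> D"
  shows "mix K \<delta> G \<in> D"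
  using normalized_mix_in_convex[OF assms(1), of K \<delta> G] assms(2,3)
  by (simp add: prob_simplex_def mix_def)

section \<open>The lexicographic order on weight vectors\<close>

lemma lex_less_trans: "lex_less K x y \<Longrightarrow> lex_less K y z \<Longrightarrow> lex_less K x z"
  unfolding lex_less_def
proof (elim exE conjE)
  fix i j assume *: "i < K" "j < K" "\<forall>k<i. x k = y k" "\<forall>k<j. y k = z k" "x i < y i" "y j < z j"
  show "\<exists>i<K. (\<forall>j<i. x j = z j) \<and> x i < z i"
  proof (rule exI[of _ "min i j"], intro conjI allI impI)
    show "x (min i j) < z (min i j)"
      using * by (cases i j rule: linorder_cases) (auto simp: min_def)
  qed (use * in auto)
qed

lemma lex_less_irrefl: "\<not> lex_less K x x"
  by (auto simp: lex_less_def)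

lemma lex_less_linear:
  assumes "x \<in> prob_simplex K" "y \<in> prob_simplex K" "x \<noteq> y"
  shows "lex_less K x y \<or> lex_less K y x"
proof -
  obtain i0 where "x i0 \<noteq> y i0" using assms(3) by auto
  define i where "i = (LEAST i. x i \<noteq> y i)"
  have i: "x i \<noteq> y i" unfolding i_def by (rule LeastI) fact
  have "\<forall>j<i. x j = y j" unfolding i_def using not_less_Least by blast
  \<comment> \<open>Simplex vectors vanish from index \<open>K\<close> on, so a first difference
    lies below \<open>K\<close>.\<close>
  moreover have "i < K" using i assms(1,2) by (force simp: prob_simplex_def not_less[symmetric])
  ultimately show ?thesis using i unfolding lex_less_def by (metis linorder_neqE)
qed

lemma lex_minimum_exists:
  assumes "finite S" "S \<noteq> {}" "S \<subseteq> prob_simplex K"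
  shows "\<exists>m\<in>S. \<forall>y\<in>S. y \<noteq> m \<longrightarrow> lex_less K m y"
  using assms
proof (induction S rule: finite_ne_induct)
  case (insert x S)
  then obtain m where m: "m \<in> S" "\<forall>y\<in>S. y \<noteq> m \<longrightarrow> lex_less K m y" by auto
  then have "lex_less K m x \<or> lex_less K x m"
    using insert.prems insert.hyps lex_less_linear[of m K x] by auto
  then show ?case
    using m lex_less_trans[of K x m] by (metis insert_iff)
qed simp

text \<open>Justifies the \<open>THE\<close> in the definition: a finite nonempty set of maximisers
  has a lexicographic minimum, and two different minima would each lie below the other.\<close>

lemma lex_min_argmax_in_argmax_set:
  assumes "finite Mn" "Mn \<noteq> {}" "Mn \<subseteq> prob_simplex K"
  shows "lex_min_argmax K T Mn G \<in> argmax_set K T Mn G"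
proof -
  let ?S = "argmax_set K T Mn G"
  obtain \<delta> where "\<delta> \<in> Mn" "\<And>\<delta>'. \<delta>' \<in> Mn \<Longrightarrow> T (mix K \<delta>' G) \<le> T (mix K \<delta> G)"
    using obtains_MAX[OF assms(1,2), of "\<lambda>\<delta>. T (mix K \<delta> G)"] Max_ge assms(1)
    by (metis finite_imageI imageI)
  then have "?S \<noteq> {}" by (auto simp: argmax_set_def)
  moreover have "?S \<subseteq> Mn" by (auto simp: argmax_set_def)
  ultimately obtain m where m: "m \<in> ?S" "\<forall>y\<in>?S. y \<noteq> m \<longrightarrow> lex_less K m y"
    using lex_minimum_exists[of ?S K] assms finite_subset by blast
  have "lex_min_argmax K T Mn G = m"
    unfolding lex_min_argmax_def
  proof (rule the_equality)
    fix d assume d: "d \<in> ?S \<and> (\<forall>\<delta>'\<in>?S. \<delta>' \<noteq> d \<longrightarrow> lex_less K d \<delta>')"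
    show "d = m"
    proof (rule ccontr)
      assume "d \<noteq> m"
      then have "lex_less K d m" "lex_less K m d" using d m by auto
      then show False using lex_less_trans lex_less_irrefl by blast
    qed
  qed (use m in simp)
  then show ?thesis using m by simp
qed

subsection \<open>The regret bound\<close>

text \<open>Passing from \<open>F\<close> to \<open>H\<close> and back costs at most
  \<open>C * z\<close> each way, and under \<open>H\<close> the recommendation beats every
  competitor in \<open>Mn\<close>. Passing from \<open>Mn\<close> to \<open>M\<close> costs the
  optimization error. All of this is deterministic; randomness will enter through \<open>H\<close>
  and \<open>z\<close>.\<close>

lemma regret_le:
  fixes D :: "(real \<Rightarrow> real) set" and T :: "(real \<Rightarrow> real) \<Rightarrow> real" and C z :: real
  assumes D_sub: "D \<subseteq> D_cdf a b"
    and D_convex: "\<forall>F\<in>D. \<forall>G\<in>D. \<forall>u::real. 0 \<le> u \<and> u \<le> 1 \<longrightarrow> (\<lambda>x. u * F x + (1 - u) * G x) \<in> D"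
    and C_pos: "C > 0"
    and T_lip: "\<forall>F\<in>D. \<forall>G\<in>D_cdf a b. \<bar>T F - T G\<bar> \<le> C * sup_dist F G"
    and M_sub: "M \<subseteq> prob_simplex K" and Mn: "Mn \<subseteq> M" "Mn \<noteq> {}" "finite Mn"
    and K: "0 < K" and F: "\<And>i. i < K \<Longrightarrow> F i \<in> D" and H: "\<And>i. i < K \<Longrightarrow> H i \<in> D_cdf a b"
    and close: "\<And>i x. i < K \<Longrightarrow> \<bar>F i x - H i x\<bar> \<le> z"
  shows "0 \<le> opt_error K T D M Mn"
    and "regret K T M F (lex_min_argmax K T Mn H) \<le> opt_error K T D M Mn + 2 * C * z"
proof -
  define G0 where "G0 = F 0"
  have G0: "G0 \<in> D" "G0 \<in> D_cdf a b" using F[OF K] D_sub by (auto simp: G0_def)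
  \<comment> \<open>Real suprema need bounded families. Cdfs are at uniform distance at most 1, so
    \<open>T\<close> stays within \<open>C\<close> of \<open>T G0\<close> on \<open>D\<close>; this
    bounds the suprema over weights and the one defining \<open>opt_error\<close>.\<close>
  have T_bdd: "T G0 - C \<le> T G" "T G \<le> T G0 + C" if "G \<in> D" for G
  proof -
    have "\<bar>T G - T G0\<bar> \<le> C * sup_dist G G0" using T_lip that G0 by auto
    also have "\<dots> \<le> C * 1"
      using that D_sub G0 C_pos by (intro mult_left_mono sup_dist_D_cdf_le_1[of _ a b]) auto
    finally show "T G0 - C \<le> T G" "T G \<le> T G0 + C" by auto
  qed
  have mix_D: "mix K \<delta> G \<in> D" if "\<delta> \<in> M" "\<And>i. i < K \<Longrightarrow> G i \<in> D" for \<delta> G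
    using mix_in_convex[OF D_convex] that M_sub by blast
  have sup_bounds: "bdd_above ((\<lambda>\<delta>. T (mix K \<delta> G)) ` S)" "(SUP \<delta>\<in>S. T (mix K \<delta> G)) \<in> {T G0 - C..T G0 + C}"
    if S: "S \<subseteq> M" "S \<noteq> {}" and G: "\<And>i. i < K \<Longrightarrow> G i \<in> D" for S G
  proof -
    have bd: "T G0 - C \<le> T (mix K \<delta> G)" "T (mix K \<delta> G) \<le> T G0 + C" if "\<delta> \<in> S" for \<delta>
      using T_bdd mix_D that S G by blast+
    then show *: "bdd_above ((\<lambda>\<delta>. T (mix K \<delta> G)) ` S)" by (intro bdd_aboveI2)
    obtain \<delta> where \<delta>: "\<delta> \<in> S" using S by auto
    have "T G0 - C \<le> T (mix K \<delta> G)" using bd \<delta> by blast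
    also have "\<dots> \<le> (SUP \<delta>\<in>S. T (mix K \<delta> G))" using * \<delta> by (intro cSUP_upper)
    finally have "T G0 - C \<le> (SUP \<delta>\<in>S. T (mix K \<delta> G))" .
    moreover have "(SUP \<delta>\<in>S. T (mix K \<delta> G)) \<le> T G0 + C" using S bd by (intro cSUP_least) auto
    ultimately show "(SUP \<delta>\<in>S. T (mix K \<delta> G)) \<in> {T G0 - C..T G0 + C}" by simp
  qed
  have M_ne: "M \<noteq> {}" using Mn by auto
  have opt: "\<bar>(SUP \<delta>\<in>M. T (mix K \<delta> F)) - (SUP \<delta>\<in>Mn. T (mix K \<delta> F))\<bar> \<le> opt_error K T D M Mn"
    unfolding opt_error_def
  proof (rule cSUP_upper)
    show "bdd_above ((\<lambda>F. \<bar>(SUP \<delta>\<in>M. T (mix K \<delta> F)) - (SUP \<delta>\<in>Mn. T (mix K \<delta> F))\<bar>) ` {F. \<forall>i<K. F i \<in> D})"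
    proof (rule bdd_aboveI2)
      fix G assume "G \<in> {F. \<forall>i<K. F i \<in> D}"
      then have "(SUP \<delta>\<in>M. T (mix K \<delta> G)) \<in> {T G0 - C..T G0 + C}"
        "(SUP \<delta>\<in>Mn. T (mix K \<delta> G)) \<in> {T G0 - C..T G0 + C}"
        using sup_bounds(2)[of M G] sup_bounds(2)[of Mn G] Mn M_ne by auto
      then show "\<bar>(SUP \<delta>\<in>M. T (mix K \<delta> G)) - (SUP \<delta>\<in>Mn. T (mix K \<delta> G))\<bar> \<le> 2 * C" by auto
    qed
  qed (use F in simp)
  then show "0 \<le> opt_error K T D M Mn" by linarith
  have diff: "\<bar>T (mix K \<delta> F) - T (mix K \<delta> H)\<bar> \<le> C * z" if "\<delta> \<in> Mn" for \<delta>
  proof -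
    have \<delta>: "\<delta> \<in> M" "\<delta> \<in> prob_simplex K" using that Mn M_sub by auto
    \<comment> \<open>The Lipschitz condition asks only one argument to lie in \<open>D\<close>: the
      true mixture does by convexity, while the mixture of \<open>H\<close> is merely in
      \<open>D_cdf a b\<close>.\<close>
    have "\<bar>T (mix K \<delta> F) - T (mix K \<delta> H)\<bar> \<le> C * sup_dist (mix K \<delta> F) (mix K \<delta> H)"
      using T_lip mix_D[of \<delta> F] mix_in_D_cdf[of \<delta> K H a b] \<delta> F H by blast
    also have "\<dots> \<le> C * z"
    proof (intro mult_left_mono sup_dist_le)
      fix x
      have "\<bar>mix K \<delta> F x - mix K \<delta> H x\<bar> = \<bar>\<Sum>i<K. \<delta> i * (F i x - H i x)\<bar>"
        by (simp add: mix_def sum_subtractf right_diff_distrib)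
      also have "\<dots> \<le> (\<Sum>i<K. \<bar>\<delta> i * (F i x - H i x)\<bar>)" by (rule sum_abs)
      \<comment> \<open>Nonnegative weights of sum 1 do not enlarge the uniform distance. The
        \<open>K\<close> marginal deviations thus control all weight vectors at once, and the size
        of \<open>Mn\<close> does not enter.\<close>
      also have "\<dots> \<le> (\<Sum>i<K. \<delta> i * z)"
        using \<delta> close by (intro sum_mono) (auto simp: abs_mult prob_simplex_def intro!: mult_mono)
      also have "\<dots> = z" using \<delta> by (simp add: prob_simplex_def sum_distrib_right[symmetric])
      finally show "\<bar>mix K \<delta> F x - mix K \<delta> H x\<bar> \<le> z" .
    qed (use C_pos in simp)
    finally show ?thesis .
  qed
  define \<delta> where "\<delta> = lex_min_argmax K T Mn H"
  have \<delta>: "\<delta> \<in> argmax_set K T Mn H"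
    unfolding \<delta>_def using Mn M_sub by (intro lex_min_argmax_in_argmax_set) auto
  have "(SUP \<delta>\<in>Mn. T (mix K \<delta> F)) \<le> T (mix K \<delta> F) + 2 * C * z"
  proof (rule cSUP_least)
    fix \<delta>' assume "\<delta>' \<in> Mn"
    then have "T (mix K \<delta>' H) \<le> T (mix K \<delta> H)" "\<delta> \<in> Mn" using \<delta> by (auto simp: argmax_set_def)
    then show "T (mix K \<delta>' F) \<le> T (mix K \<delta> F) + 2 * C * z"
      using diff[OF \<open>\<delta>' \<in> Mn\<close>] diff[OF \<open>\<delta> \<in> Mn\<close>] by linarith
  qed (use Mn in simp)
  with opt show "regret K T M F (lex_min_argmax K T Mn H) \<le> opt_error K T D M Mn + 2 * C * z"
    unfolding regret_def \<delta>_def[symmetric] by linarith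
qed

text \<open>Lets a countable supremum, whose measurability is immediate, stand in for the supremum
  over the real line.\<close>

lemma rational_bound_imp_bound:
  fixes h :: "real \<Rightarrow> real"
  assumes "continuous (at_right x) h" and "\<And>q. q \<in> \<rat> \<Longrightarrow> h q \<le> z"
  shows "h x \<le> z"
proof (rule ccontr)
  assume "\<not> h x \<le> z"
  then have "eventually (\<lambda>y. z < h y) (at_right x)"
    using assms(1) order_tendstoD(1)[of h "h x" "at_right x" z] by (simp add: continuous_within)
  then obtain y where y: "x < y" "\<And>w. x < w \<Longrightarrow> w < y \<Longrightarrow> z < h w"
    unfolding eventually_at_right_field by blast
  obtain q where "q \<in> \<rat>" "x < q" "q < y" using Rats_dense_in_real[OF y(1)] by blast
  with y(2)[of q] assms(2)[of q] show False by simp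
qed

lemma expected_max_deviation_constant:
  fixes K :: nat and \<beta> C :: real
  assumes "2 \<le> K" "0 < \<beta>"
  shows "2 * sqrt ((1 + ln (2 * real K)) / (31/20 * \<beta>)) \<le> 301/100 * sqrt (ln (real K) / \<beta>)"
proof -
  have L: "2/3 \<le> ln (2::real)" by (rule ln2_ge_two_thirds)
  have K: "ln 2 \<le> ln (real K)" using assms by simp
  \<comment> \<open>Here \<open>x\<close> stands for \<open>ln 2\<close> and \<open>y\<close> for
    \<open>ln K\<close>. Both 1 and \<open>x\<close> are absorbed into \<open>y\<close>, by
    \<open>1 \<le> 3/2 * y\<close> and \<open>x \<le> y\<close>; what remains is that 280/31, about
    9.032, is below 9.0601, the square of 3.01.\<close>
  have key: "80/31 * (1 + x + y) \<le> 90601/10000 * y" if "2/3 \<le> x" "x \<le> y" for x y :: real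
  proof -
    have "80/31 * (1 + x + y) \<le> 80/31 * (7/2 * y)" using that by (intro mult_left_mono) auto
    also have "\<dots> = 280/31 * y" by simp
    also have "\<dots> \<le> 90601/10000 * y" using that by (intro mult_right_mono) auto
    finally show ?thesis .
  qed
  have "4 * ((1 + ln (2 * real K)) / (31/20)) \<le> (301/100)\<^sup>2 * ln (real K)"
  proof -
    have "ln (2 * real K) = ln 2 + ln (real K)" using assms by (simp add: ln_mult)
    then have "4 * ((1 + ln (2 * real K)) / (31/20)) = 80/31 * (1 + ln 2 + ln (real K))" by simp
    also have "\<dots> \<le> 90601/10000 * ln (real K)" by (rule key[OF L K])
    finally show ?thesis by (simp add: power2_eq_square)
  qed
  then have "4 * ((1 + ln (2 * real K)) / (31/20)) / \<beta> \<le> (301/100)\<^sup>2 * ln (real K) / \<beta>"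
    using assms by (intro divide_right_mono) auto
  then have "sqrt (2\<^sup>2 * ((1 + ln (2 * real K)) / (31/20 * \<beta>))) \<le> sqrt ((301/100)\<^sup>2 * (ln (real K) / \<beta>))"
    by (intro real_sqrt_le_mono) (simp add: divide_divide_eq_left)
  then show ?thesis by (simp only: real_sqrt_mult real_sqrt_abs abs_numeral)
qed

text \<open>\<open>P\<close> is the joint law of one outcome vector, so dependence between
  treatments is unrestricted; the product over subjects makes the vectors i.i.d. A bound for every
  such \<open>P\<close> bounds the supremum.\<close>

theorem theorem4p1:
  fixes a b C :: real and K n :: nat
    and D :: "(real \<Rightarrow> real) set"
    and T :: "(real \<Rightarrow> real) \<Rightarrow> real"
    and M Mn :: "(nat \<Rightarrow> real) set"
    and Part :: "nat \<Rightarrow> nat set"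
    and P :: "(nat \<Rightarrow> real) measure"
  assumes ab: "a < b"
    and K2: "K \<ge> 2"
    and D_sub: "D \<subseteq> D_cdf a b" and D_ne: "D \<noteq> {}"
    and D_convex: "\<forall>F\<in>D. \<forall>G\<in>D. \<forall>u::real. 0 \<le> u \<and> u \<le> 1 \<longrightarrow>
                      (\<lambda>x. u * F x + (1 - u) * G x) \<in> D"
    and C_pos: "C > 0"
    and T_lip: "\<forall>F\<in>D. \<forall>G\<in>D_cdf a b. \<bar>T F - T G\<bar> \<le> C * sup_dist F G"
    and T_meas: "\<forall>m. \<forall>\<delta>\<in>prob_simplex m.
        (\<lambda>x. T (mix m \<delta> (\<lambda>j y. if x j \<le> y then 1 else 0)))
          \<in> borel_measurable (PiM {..<m} (\<lambda>_. restrict_space borel {a..b}))"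
    and M_sub: "M \<subseteq> prob_simplex K" and M_closed: "closed M"
    and M_two: "\<exists>x\<in>M. \<exists>y\<in>M. x \<noteq> y"
    and nK: "n \<ge> K"
    and Pi_ne: "\<forall>j<K. Part j \<noteq> {}"
    and Pi_disj: "\<forall>i<K. \<forall>j<K. i \<noteq> j \<longrightarrow> Part i \<inter> Part j = {}"
    and Pi_cover: "(\<Union>j<K. Part j) = {..<n}"
    and Mn_sub: "Mn \<subseteq> M" and Mn_ne: "Mn \<noteq> {}" and Mn_fin: "finite Mn"
    and P_prob: "prob_space P"
    and P_sets: "sets P = sets (PiM {..<K} (\<lambda>_. restrict_space borel {a..b}))"
    and P_marg: "\<forall>i<K. marg P i \<in> D"
  shows "(\<integral>\<omega>. regret K T M (marg P) (sa_policy K T Mn Part \<omega>) \<partial>(PiM {..<n} (\<lambda>_. P)))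
          \<le> opt_error K T D M Mn
             + 301/100 * C * sqrt (ln (real K) / real (Min ((\<lambda>j. card (Part j)) ` {..<K})))"
proof -
  interpret Q: product_prob_space "\<lambda>_. P" "{..<n}" by (rule product_prob_space_const[OF P_prob])
  let ?Q = "PiM {..<n} (\<lambda>_. P)"
  have Part_sub: "Part j \<subseteq> {..<n}" if "j < K" for j using Pi_cover that by blast
  then have Part_fin: "finite (Part j)" if "j < K" for j using that finite_subset by blast
  have space_P: "space P = PiE {..<K} (\<lambda>_. {a..b})"
    using sets_eq_imp_space_eq[OF P_sets] by (simp add: space_PiM space_restrict_space)
  have X: "(\<lambda>y. y j) \<in> borel_measurable P" if "j < K" for j
  proof -
    have "(\<lambda>y. y j) \<in> measurable P (restrict_space borel {a..b})"
      unfolding measurable_cong_sets[OF P_sets refl] using that by (intro measurable_component_singleton) simp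
    from measurable_compose[OF this measurable_restrict_space1[OF measurable_ident]]
    show ?thesis by simp
  qed
  have F_D: "marg P j \<in> D" if "j < K" for j using P_marg that by blast
  then have F_cdf: "marg P j \<in> D_cdf a b" if "j < K" for j using that D_sub by blast
  have H_cdf: "emp_cdf Part j \<omega> \<in> D_cdf a b" if "j < K" "\<omega> \<in> space ?Q" for j \<omega>
  proof (rule emp_cdf_in_D_cdf)
    fix t assume "t \<in> Part j"
    then have "\<omega> t \<in> space P" using that Part_sub by (auto simp: space_PiM PiE_iff)
    then show "\<omega> t j \<in> {a..b}" using \<open>j < K\<close> unfolding space_P by (auto simp: PiE_iff)
  qed (use that Part_fin Pi_ne in auto)
  have emp: "emp_cdf Part j \<omega> x = real (card {t\<in>Part j. \<omega> t j \<le> x}) / real (card (Part j))"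
    if "j < K" for j \<omega> x
    using Part_fin[OF that] by (simp add: emp_cdf_def sum.If_cases Int_def)
  \<comment> \<open>Only rational thresholds enter \<open>Z\<close>, which keeps it measurable;
    \<open>close\<close> recovers all real thresholds by right continuity.\<close>
  define r :: "nat \<Rightarrow> real" where "r = from_nat_into \<rat>"
  have range_r: "range r = \<rat>"
    unfolding r_def by (intro range_from_nat_into countable_rat) (auto intro: exI[of _ 0])
  define dev where "dev \<omega> p = \<bar>emp_cdf Part (fst p) \<omega> (r (snd p)) - marg P (fst p) (r (snd p))\<bar>" for \<omega> p
  define I where "I = {..<K} \<times> (UNIV :: nat set)"
  have I: "countable I" "I \<noteq> {}" using K2 by (auto simp: I_def lessThan_empty_iff)
  define Z where "Z \<omega> = (SUP p\<in>I. dev \<omega> p)" for \<omega>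
  have dev_le: "dev \<omega> p \<le> 1" if "p \<in> I" "\<omega> \<in> space ?Q" for p \<omega>
  proof -
    have "fst p < K" using that by (auto simp: I_def)
    from D_cdf_bounds[OF H_cdf[OF this that(2)], of "r (snd p)"] D_cdf_bounds[OF F_cdf[OF this], of "r (snd p)"]
    show ?thesis unfolding dev_def by linarith
  qed
  then have bdd: "bdd_above (dev \<omega> ` I)" if "\<omega> \<in> space ?Q" for \<omega>
    using that by (intro bdd_aboveI2) auto
  have dev_meas: "(\<lambda>\<omega>. dev \<omega> p) \<in> borel_measurable ?Q" if "p \<in> I" for p
  proof -
    have p: "fst p < K" using that by (auto simp: I_def)
    have [measurable]: "(\<lambda>\<omega>. \<omega> t (fst p)) \<in> borel_measurable ?Q" if "t \<in> Part (fst p)" for t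
    proof -
      have "(\<lambda>\<omega>. \<omega> t) \<in> measurable ?Q P"
        using that Part_sub[OF p] by (intro measurable_component_singleton) auto
      from measurable_compose[OF this X[OF p]] show ?thesis .
    qed
    show ?thesis unfolding dev_def emp_cdf_def by measurable
  qed
  have Z_meas: "Z \<in> borel_measurable ?Q"
    unfolding Z_def[abs_def] by (intro borel_measurable_cSUP I dev_meas bdd)
  have dev_Z: "dev \<omega> p \<le> Z \<omega>" if "p \<in> I" "\<omega> \<in> space ?Q" for p \<omega>
    unfolding Z_def using that bdd by (intro cSUP_upper) auto
  have Z_nonneg: "0 \<le> Z \<omega>" if "\<omega> \<in> space ?Q" for \<omega>
  proof -
    obtain p where "p \<in> I" using I by auto
    from dev_Z[OF this that] show ?thesis by (simp add: dev_def)
  qed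
  have Z_le: "Z \<omega> \<le> 1" if "\<omega> \<in> space ?Q" for \<omega>
    unfolding Z_def using dev_le that I by (intro cSUP_least) auto
  have close: "\<bar>marg P j x - emp_cdf Part j \<omega> x\<bar> \<le> Z \<omega>" if "j < K" "\<omega> \<in> space ?Q" for j x \<omega>
  proof (rule rational_bound_imp_bound[where h = "\<lambda>x. \<bar>marg P j x - emp_cdf Part j \<omega> x\<bar>"])
    show "continuous (at_right x) (\<lambda>x. \<bar>marg P j x - emp_cdf Part j \<omega> x\<bar>)"
      using F_cdf[OF that(1)] H_cdf[OF that]
      by (intro continuous_rabs continuous_diff) (auto simp: D_cdf_def)
    fix q :: real assume "q \<in> \<rat>"
    then obtain k where "q = r k" using range_r by auto
    with dev_Z[of "(j, k)" \<omega>] that show "\<bar>marg P j q - emp_cdf Part j \<omega> q\<bar> \<le> Z \<omega>"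
      by (simp add: dev_def I_def abs_minus_commute)
  qed
  define \<beta> where "\<beta> = real (Min ((\<lambda>j. card (Part j)) ` {..<K}))"
  have \<beta>_le: "\<beta> \<le> real (card (Part j))" if "j < K" for j
    using that by (auto simp: \<beta>_def intro!: Min_le)
  have \<beta>_pos: "0 < \<beta>"
    using K2 Pi_ne Part_fin unfolding \<beta>_def by (simp add: Min_gr_iff card_gt_0_iff lessThan_empty_iff)
  have tail: "Q.prob {\<omega>\<in>space ?Q. e < Z \<omega>} \<le> 2 * real K * exp (- (31/20 * \<beta> * e\<^sup>2))" if e: "0 < e" for e
  proof -
    define E where "E j = {\<omega>\<in>space ?Q. \<exists>k. e \<le> dev \<omega> (j, k)}" for j
    have E_sets: "E j \<in> sets ?Q" if "j < K" for j
    proof -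
      have [measurable]: "(\<lambda>\<omega>. dev \<omega> (j, k)) \<in> borel_measurable ?Q" for k
        using that by (intro dev_meas) (simp add: I_def)
      show ?thesis unfolding E_def by measurable
    qed
    have E_prob: "Q.prob (E j) \<le> 2 * exp (- (31/20 * \<beta> * e\<^sup>2))" if j: "j < K" for j
    proof -
      have "E j = {\<omega>\<in>space ?Q. \<exists>k. e \<le> \<bar>real (card {t\<in>Part j. \<omega> t j \<le> r k}) / real (card (Part j))
          - measure P {y\<in>space P. y j \<le> r k}\<bar>}"
        by (simp add: E_def dev_def emp[OF j] marg_def)
      then have "Q.prob (E j) \<le> 2 * exp (- (31/20 * real (card (Part j)) * e\<^sup>2))"
        using two_sided_dkw[OF P_prob _ Part_sub[OF j] _ e X[OF j], of r] Pi_ne j by simp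
      also have "\<dots> \<le> 2 * exp (- (31/20 * \<beta> * e\<^sup>2))"
        using \<beta>_le[OF j] by (auto intro!: mult_right_mono)
      finally show ?thesis .
    qed
    \<comment> \<open>A union bound over treatments. The supremum \<open>Z\<close> need not be
      attained, but the strict inequality \<open>e < Z \<omega>\<close> produces a single deviation
      above \<open>e\<close>.\<close>
    have "{\<omega>\<in>space ?Q. e < Z \<omega>} \<subseteq> (\<Union>j<K. E j)"
    proof safe
      fix \<omega> assume \<omega>: "\<omega> \<in> space ?Q" "e < Z \<omega>"
      then obtain p where "p \<in> I" "e < dev \<omega> p"
        unfolding Z_def using less_cSUP_iff[OF I(2) bdd] by auto
      then show "\<omega> \<in> (\<Union>j<K. E j)"
        using \<omega> by (auto simp: I_def E_def intro!: exI[of _ "snd p"] bexI[of _ "fst p"])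
    qed
    then have "Q.prob {\<omega>\<in>space ?Q. e < Z \<omega>} \<le> Q.prob (\<Union>j<K. E j)"
      using E_sets by (intro Q.finite_measure_mono) auto
    also have "\<dots> \<le> (\<Sum>j<K. Q.prob (E j))"
      using E_sets by (intro Q.finite_measure_subadditive_finite) auto
    also have "\<dots> \<le> (\<Sum>j<K. 2 * exp (- (31/20 * \<beta> * e\<^sup>2)))"
      using E_prob by (intro sum_mono) auto
    finally show ?thesis by simp
  qed
  have "Q.expectation Z \<le> sqrt ((1 + ln (2 * real K)) / (31/20 * \<beta>))"
    using Z_meas Z_nonneg Z_le \<beta>_pos K2 tail
    by (intro Q.expectation_le_of_subgaussian_tail[where u = 1]) auto
  then have EZ: "2 * Q.expectation Z \<le> 301/100 * sqrt (ln (real K) / \<beta>)"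
    using expected_max_deviation_constant[OF K2 \<beta>_pos] by linarith
  have Z_int: "integrable ?Q Z"
    using Z_meas Z_nonneg Z_le by (intro Q.integrable_const_bound[of _ 1]) auto
  let ?opt = "opt_error K T D M Mn"
  have regret: "0 \<le> ?opt" "regret K T M (marg P) (sa_policy K T Mn Part \<omega>) \<le> ?opt + 2 * C * Z \<omega>"
    if "\<omega> \<in> space ?Q" for \<omega>
    using regret_le[OF D_sub D_convex C_pos T_lip M_sub Mn_sub Mn_ne Mn_fin, of "marg P" "\<lambda>j. emp_cdf Part j \<omega>" "Z \<omega>"]
      K2 F_D H_cdf close that by (auto simp: sa_policy_def)
  \<comment> \<open>The regret itself need not be integrable: its integral is then \<open>0\<close>, which is why the
    upper bound has to be nonnegative.\<close>
  have "(\<integral>\<omega>. regret K T M (marg P) (sa_policy K T Mn Part \<omega>) \<partial>?Q) \<le> (\<integral>\<omega>. ?opt + 2 * C * Z \<omega> \<partial>?Q)"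
    using regret Z_nonneg C_pos Z_int by (intro integral_mono') auto
  also have "\<dots> = ?opt + C * (2 * Q.expectation Z)"
    using Z_int Q.P.prob_space by simp
  also have "\<dots> \<le> ?opt + C * (301/100 * sqrt (ln (real K) / \<beta>))"
    using EZ C_pos by (intro add_left_mono mult_left_mono) auto
  finally show ?thesis by (simp add: \<beta>_def mult_ac)
qed

end
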